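(* Let $(W^*,b^*,c^* )\in\mathbb{R}^{m\times m}\times\mathbb{R}^m\times\mathbb{R}$ and $\mathcal{T}_*:=\{i : y_i(\tfrac12 (x^i)^TW^*x^i+(b^* )^Tx^i+c^* )=1\}$. Suppose that the only vector $z=(z_i)_{i\in\mathcal{T}_*}\in\mathbb{R}^{|\mathcal{T}_*|}$ with $z\ge0$ and $\sum_{i\in\mathcal{T}_*}z_i\nabla F_i(W^*,b^*,c^* )=(0_{m\times m},0_m,0)$ is $z=0$. For $z^*\in\mathbb{R}^n$ let $\mathcal{K}(z^* )$ be the set of all $(D_1,d_2,d_3)\in\mathbb{R}^{m\times m}\times\mathbb{R}^m\times\mathbb{R}$ such that for every $i\in\mathcal{T}_*$: either $\tfrac12(x^i)^TD_1x^i+d_2^Tx^i+d_3=0$ and $z_i^*\ge0$, or $\tfrac12(x^i)^TD_1x^i+d_2^Tx^i+d_3\ne0$ and $z_i^*=0$. Then the following assertions hold. (i) If $(W^*,b^*,c^* )$ is a local minimizer of problem (Q), then $0\in\partial(f+\lambda\varphi)(W^*,b^*,c^* )$, i.e. $-\nabla f(W^*,b^*,c^* )\in\lambda\,\partial\varphi(W^*,b^*,c^* )=\partial\varphi(W^*,b^*,c^* )$, and there exists $z^*\in\Lambda((W^*,b^*,c^* ),-\nabla f(W^*,b^*,c^* ))$ such that $$\sum_{i=1}^n\|D_1x^i+d_2\|^2\ge0\quad\text{for all }(D_1,d_2,d_3)\in\mathcal{K}(z^* ).$$ (ii) If $0\in\partial(f+\lambda\varphi)(W^*,b^*,c^* )$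 and there exists $z^*\in\Lambda((W^*,b^*,c^* ),-\nabla f(W^*,b^*,c^* ))$ such that $$\sum_{i=1}^n\|D_1x^i+d_2\|^2>0\quad\text{for all }(D_1,d_2,d_3)\in\mathcal{K}(z^* )\setminus\{0\},$$ then $(W^*,b^*,c^* )$ is a local minimizer of problem (Q) and the second-order growth condition holds: there exist $\kappa>0$ and $\delta>0$ such that for every $(W,b,c)\in B((W^*,b^*,c^* ),\delta)$, $$f(W,b,c)+\lambda\|F(W,b,c)_+\|_0\ \ge\ f(W^*,b^*,c^* )+\lambda\|F(W^*,b^*,c^* )_+\|_0+\kappa\big(\|W-W^*\|_F^2+\|(b,c)-(b^*,c^* )\|^2\big).$$
   Context: Data: points $x^1,\dots,x^n\in\mathbb{R}^m$ with labels $y_1,\dots,y_n\in\{-1,+1\}$, and a penalty parameter $\lambda>0$. The 0-1 loss is $\ell_{0/1}(t)=1$ if $t>0$ and $0$ if $t\le0$; for $y\in\mathbb{R}^n$, $g(y)=\|y_+\|_0=\sum_i\ell_{0/1}(y_i)$. The space $\mathbb{R}^{m\times m}\times\mathbb{R}^m\times\mathbb{R}$ carries the product Euclidean (Frobenius) inner product, and $B(\cdot,\delta)$ is the open ball of radius $\delta$ for the corresponding norm. Put $$f(W,b,c)=\sum_{i=1}^n\tfrac12\|Wx^i+b\|^2,\quad F_i(W,b,c)=1-y_i\big(\tfrac12(x^i)^TWx^i+b^Tx^i+c\big),\quad F=(F_1,\dots,F_n)^T,\quad \varphi=\sum_{i=1}^n\ell_{0/1}(F_i)=\|F(\cdot)_+\|_0.$$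 Thus $\nabla F_i(W,b,c)=-y_i(\tfrac12x^i(x^i)^T,x^i,1)$, and for $z\in\mathbb{R}^n$, $\nabla F(W,b,c)^Tz=\sum_{i=1}^nz_i\nabla F_i(W,b,c)$. Problem (Q) is $\min f(W,b,c)+\lambda\varphi(W,b,c)$ over $W\in\mathbb{R}^{m\times m}$, $b\in\mathbb{R}^m$, $c\in\mathbb{R}$. For a function $h$ on a Euclidean space, finite at $\bar x$, the regular subdifferential is $\hat\partial h(\bar x)=\{v : \liminf_{x\to\bar x}\frac{h(x)-h(\bar x)-\langle v,x-\bar x\rangle}{\|x-\bar x\|}\ge0\}$ and the limiting subdifferential is $\partial h(\bar x)=\{v : \exists\,x_k\to\bar x,\ h(x_k)\to h(\bar x),\ v_k\in\hat\partial h(x_k),\ v_k\to v\}$. The multiplier set is $$\Lambda((W^*,b^*,c^* ),V)=\{z\in\partial g(F(W^*,b^*,c^* )) : \nabla F(W^*,b^*,c^* )^Tz=V\},$$ where $\partial g(F(W^*,b^*,c^* ))\subset\mathbb{R}^n$ is the limiting subdifferential of $g$ at the point $F(W^*,b^*,c^* )$. *)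

theory Defs
  imports "HOL-Analysis.Analysis"
begin

text \<open>
  The index types \<open>'m\<close> and \<open>'n\<close> stand for \<open>{1..m}\<close> and \<open>{1..n}\<close>.  The norm and inner product
  which the library puts on \<open>real^'m^'m\<close> are the Frobenius ones, and those on the product type are
  the product Euclidean ones.
\<close>

type_synonym 'm qparam = "(real^'m^'m) \<times> (real^'m) \<times> real"

definition grad :: "('a::euclidean_space \<Rightarrow> real) \<Rightarrow> 'a \<Rightarrow> 'a" where
  "grad h p = (THE D. GDERIV h p :> D)"

text \<open>The filter \<open>at p\<close> excludes \<open>p\<close> itself, so the quotient below is never of the form 0/0.\<close>

definition regular_subdiff :: "('a::euclidean_space \<Rightarrow> real) \<Rightarrow> 'a \<Rightarrow> 'a set" where
  "regular_subdiff h p =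
     {v. Liminf (at p) (\<lambda>q. ereal ((h q - h p - v \<bullet> (q - p)) / norm (q - p))) \<ge> 0}"

definition limiting_subdiff :: "('a::euclidean_space \<Rightarrow> real) \<Rightarrow> 'a \<Rightarrow> 'a set" where
  "limiting_subdiff h p =
     {v. \<exists>X V. X \<longlonglongrightarrow> p \<and> (\<lambda>k. h (X k)) \<longlonglongrightarrow> h p \<and>
               (\<forall>k::nat. V k \<in> regular_subdiff h (X k)) \<and> V \<longlonglongrightarrow> v}"

definition local_minimizer :: "('a::metric_space \<Rightarrow> real) \<Rightarrow> 'a \<Rightarrow> bool" where
  "local_minimizer h p \<longleftrightarrow> (\<exists>\<delta>>0. \<forall>q\<in>ball p \<delta>. h p \<le> h q)"

definition loss01 :: "real \<Rightarrow> real" where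
  "loss01 t = (if t > 0 then 1 else 0)"

definition pos_part :: "real^'n \<Rightarrow> real^'n" where
  "pos_part u = (\<chi> i. max 0 (u $ i))"

definition norm0 :: "real^'n \<Rightarrow> real" where
  "norm0 u = real (card {i. u $ i \<noteq> 0})"

definition g_fun :: "real^'n \<Rightarrow> real" where
  "g_fun u = norm0 (pos_part u)"

definition quad :: "'m::finite qparam \<Rightarrow> real^'m \<Rightarrow> real" where
  "quad = (\<lambda>(W, b, c) u. 1/2 * (u \<bullet> (W *v u)) + b \<bullet> u + c)"

definition f_obj :: "('n::finite \<Rightarrow> real^'m) \<Rightarrow> 'm::finite qparam \<Rightarrow> real" where
  "f_obj x = (\<lambda>(W, b, c). \<Sum>i\<in>UNIV. 1/2 * (norm (W *v x i + b))\<^sup>2)"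

definition F_comp :: "('n \<Rightarrow> real^'m) \<Rightarrow> ('n \<Rightarrow> real) \<Rightarrow> 'n \<Rightarrow> 'm::finite qparam \<Rightarrow> real" where
  "F_comp x y i p = 1 - y i * quad p (x i)"

definition F_map :: "('n::finite \<Rightarrow> real^'m) \<Rightarrow> ('n \<Rightarrow> real) \<Rightarrow> 'm::finite qparam \<Rightarrow> real^'n" where
  "F_map x y p = (\<chi> i. F_comp x y i p)"

definition phi :: "('n::finite \<Rightarrow> real^'m) \<Rightarrow> ('n \<Rightarrow> real) \<Rightarrow> 'm::finite qparam \<Rightarrow> real" where
  "phi x y p = (\<Sum>i\<in>UNIV. loss01 (F_comp x y i p))"

definition Q_obj :: "('n::finite \<Rightarrow> real^'m) \<Rightarrow> ('n \<Rightarrow> real) \<Rightarrow> real \<Rightarrow> 'm::finite qparam \<Rightarrow> real" where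
  "Q_obj x y lam p = f_obj x p + lam * phi x y p"

definition active :: "('n \<Rightarrow> real^'m) \<Rightarrow> ('n \<Rightarrow> real) \<Rightarrow> 'm::finite qparam \<Rightarrow> 'n set" where
  "active x y p = {i. y i * quad p (x i) = 1}"

definition multipliers ::
    "('n::finite \<Rightarrow> real^'m) \<Rightarrow> ('n \<Rightarrow> real) \<Rightarrow> 'm::finite qparam \<Rightarrow> 'm qparam \<Rightarrow> (real^'n) set" where
  "multipliers x y p V =
     {z \<in> limiting_subdiff g_fun (F_map x y p). (\<Sum>i\<in>UNIV. z $ i *\<^sub>R grad (F_comp x y i) p) = V}"

definition critical_set ::
    "('n::finite \<Rightarrow> real^'m) \<Rightarrow> ('n \<Rightarrow> real) \<Rightarrow> 'm::finite qparam \<Rightarrow> real^'n \<Rightarrow> 'm qparam set" where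
  "critical_set x y p z =
     {D. \<forall>i\<in>active x y p. quad D (x i) = 0 \<and> z $ i \<ge> 0 \<or> quad D (x i) \<noteq> 0 \<and> z $ i = 0}"

lemma g_fun_eq_sum: "g_fun u = (\<Sum>i\<in>UNIV. loss01 (u $ i))"
proof -
  have "{i. pos_part u $ i \<noteq> 0} = {i. u $ i > 0}"
    by (auto simp: pos_part_def max_def)
  then show ?thesis
    by (simp add: g_fun_def norm0_def loss01_def flip: sum.inter_filter)
qed

lemma phi_eq: "phi x y p = g_fun (F_map x y p)"
  by (simp add: g_fun_eq_sum phi_def F_map_def)

lemma grad_eqI:
  assumes "GDERIV h p :> D"
  shows "grad h p = D"
  unfolding grad_def
proof (rule the_equality)
  fix D' assume "GDERIV h p :> D'"
  then have "(\<lambda>h. h \<bullet> D') = (\<lambda>h. h \<bullet> D)"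
    using assms unfolding gderiv_def by (rule has_derivative_unique)
  then have "u \<bullet> D' = u \<bullet> D" for u by (rule fun_cong)
  then show "D' = D" using vector_eq_ldot by metis
qed (rule assms)

lemma inner_outer:
  fixes u :: "real^'m::finite"
  shows "W \<bullet> (\<chi> k l. u $ k * u $ l) = u \<bullet> (W *v u)"
  by (simp add: inner_vec_def matrix_vector_mult_def sum_distrib_left ac_simps)

lemma GDERIV_affine: "GDERIV (\<lambda>q. 1 - a * (q \<bullet> G)) p :> - a *\<^sub>R G"
  unfolding gderiv_def
  by (rule has_derivative_eq_rhs, (rule derivative_intros)+) auto

lemma grad_F_comp:
  "grad (F_comp x y i) p = - y i *\<^sub>R ((1/2) *\<^sub>R (\<chi> k l. x i $ k * x i $ l), x i, 1)"
proof (rule grad_eqI)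
  have quad: "quad q (x i) = q \<bullet> ((1/2) *\<^sub>R (\<chi> k l. x i $ k * x i $ l), x i, 1)" for q
    by (cases q) (simp add: quad_def inner_outer)
  have "F_comp x y i = (\<lambda>q. 1 - y i * (q \<bullet> ((1/2) *\<^sub>R (\<chi> k l. x i $ k * x i $ l), x i, 1)))"
    by (rule ext) (simp only: F_comp_def quad)
  then show "GDERIV (F_comp x y i) p :> - y i *\<^sub>R ((1/2) *\<^sub>R (\<chi> k l. x i $ k * x i $ l), x i, 1)"
    by (simp only: GDERIV_affine)
qed

end

theory Submission
  imports Defs
begin

text \<open>
  The penalty \<open>\<phi>\<close> counts how many of finitely many affine functions are positive, so near a point
  \<open>p\<close> it equals \<open>\<phi>(p)\<close> plus the number of active indices whose gradient makes a positive inner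
  product with the displacement.  On the polyhedral cone where no active gradient does so, \<open>\<phi>\<close> is
  constant; off the cone it jumps up by at least one, which outweighs every first-order term.  Hence
  the regular subdifferential of \<open>\<phi>\<close> at \<open>p\<close> is exactly the polar of that cone
  (\<open>regular_subdiff_violations\<close>), and it is in particular invariant under positive scaling.  The
  function \<open>g\<close> is the special case of the coordinate functions, for which the polar cone is explicit.

  Necessity.  At a local minimizer, moving along the cone leaves \<open>\<phi>\<close> unchanged, so \<open>f\<close> cannot
  decrease to first order and \<open>- grad f\<close> lies in the polar cone
  (\<open>local_minimizer_imp_stationary\<close>).  Farkas' lemma writes it as a nonnegative combination of
  active gradients, and the coefficients form the multiplier.

  Sufficiency.  Since \<open>f\<close> is quadratic with \<open>- grad f\<close> equal to the multiplier combination of the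
  gradients, its increment along \<open>d\<close> is \<open>f(d)\<close> minus the inner product of that combination with
  \<open>d\<close>.  On the unit vectors of the cone both contributions are nonnegative, and they cannot vanish
  together: if the linear one vanishes, then by complementarity \<open>d\<close> is in the critical set, where
  \<open>f(d)\<close> is positive.  Compactness gives a uniform lower bound, and homogeneity turns it into
  quadratic growth on the cone.  Off the cone the jump of \<open>\<phi>\<close> takes over
  (\<open>violations_second_order_growth\<close>).
\<close>

section \<open>Counting positive affine functions\<close>

definition violations :: "('n::finite \<Rightarrow> real) \<Rightarrow> ('n \<Rightarrow> 'a::euclidean_space) \<Rightarrow> 'a \<Rightarrow> real" where
  "violations c G p = (\<Sum>i\<in>UNIV. loss01 (c i + G i \<bullet> p))"

definition tight :: "('n::finite \<Rightarrow> real) \<Rightarrow> ('n \<Rightarrow> 'a::euclidean_space) \<Rightarrow> 'a \<Rightarrow> 'n set" where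
  "tight c G p = {i. c i + G i \<bullet> p = 0}"

lemma loss01_nonneg: "0 \<le> loss01 t"
  by (simp add: loss01_def)

text \<open>
  Affine functions that do not vanish at the base point keep their sign nearby; only the tight ones can
  make the count change, and for these the value at the displaced point is purely linear.
\<close>

lemma violations_local:
  fixes G :: "'n::finite \<Rightarrow> 'a::euclidean_space"
  shows "\<forall>\<^sub>F d in nhds 0. violations c G (p + d) = violations c G p + (\<Sum>i\<in>tight c G p. loss01 (G i \<bullet> d))"
proof -
  have "\<forall>\<^sub>F d in nhds 0. loss01 (c i + G i \<bullet> (p + d)) =
      loss01 (c i + G i \<bullet> p) + (if i \<in> tight c G p then loss01 (G i \<bullet> d) else 0)" for i
  proof (cases "i \<in> tight c G p")
    case True
    then have "c i + G i \<bullet> (p + d) = G i \<bullet> d" for d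
      by (simp add: tight_def inner_add_right)
    with True show ?thesis
      by (simp add: tight_def loss01_def)
  next
    case False
    have "((\<lambda>d. d) \<longlongrightarrow> 0) (nhds (0::'a))"
      by (rule filterlim_ident)
    then have lim: "((\<lambda>d. c i + G i \<bullet> (p + d)) \<longlongrightarrow> c i + G i \<bullet> (p + 0)) (nhds 0)"
      by (intro tendsto_intros)
    have "c i + G i \<bullet> p < 0 \<or> c i + G i \<bullet> p > 0"
      using False by (auto simp: tight_def)
    then have "\<forall>\<^sub>F d in nhds 0. (c i + G i \<bullet> (p + d) > 0) = (c i + G i \<bullet> p > 0)"
    proof
      assume neg: "c i + G i \<bullet> p < 0"
      then show ?thesis
        using order_tendstoD(2)[OF lim, of 0] by (auto elim!: eventually_mono)
    next
      assume pos: "c i + G i \<bullet> p > 0"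
      then show ?thesis
        using order_tendstoD(1)[OF lim, of 0] by (auto elim!: eventually_mono)
    qed
    with False show ?thesis
      by (auto simp: loss01_def elim!: eventually_mono)
  qed
  then have "\<forall>\<^sub>F d in nhds 0. \<forall>i. loss01 (c i + G i \<bullet> (p + d)) =
      loss01 (c i + G i \<bullet> p) + (if i \<in> tight c G p then loss01 (G i \<bullet> d) else 0)"
    by (simp add: eventually_all_finite)
  then show ?thesis
    by (rule eventually_mono)
      (simp add: violations_def sum.distrib flip: sum.inter_restrict)
qed

text \<open>
  This dichotomy drives every local estimate below: the displacement is either in the cone, at no
  cost, or it costs at least one unit.
\<close>

lemma sum_loss01_cases:
  assumes "finite A"
  shows "(\<forall>i\<in>A. s i \<le> 0) \<and> (\<Sum>i\<in>A. loss01 (s i)) = 0 \<or> (\<Sum>i\<in>A. loss01 (s i)) \<ge> 1"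
proof (cases "\<forall>i\<in>A. s i \<le> 0")
  case True
  then have "(\<Sum>i\<in>A. loss01 (s i)) = 0"
    by (intro sum.neutral) (auto simp: loss01_def)
  with True show ?thesis by blast
next
  case False
  then obtain i where i: "i \<in> A" "s i > 0" by force
  have "loss01 (s i) \<le> (\<Sum>i\<in>A. loss01 (s i))"
    using assms i by (intro member_le_sum loss01_nonneg) auto
  with i show ?thesis by (simp add: loss01_def)
qed

lemma violations_along_cone:
  assumes "\<forall>i\<in>tight c G p. G i \<bullet> d \<le> 0"
  shows "\<forall>\<^sub>F t in at_right 0. violations c G (p + t *\<^sub>R d) = violations c G p"
proof -
  have "((\<lambda>t. t *\<^sub>R d) \<longlongrightarrow> 0 *\<^sub>R d) (at_right 0)"
    by (intro tendsto_intros)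
  then have "filterlim (\<lambda>t. t *\<^sub>R d) (nhds 0) (at_right 0)" by simp
  from eventually_compose_filterlim[OF violations_local this]
  have "\<forall>\<^sub>F t in at_right 0. violations c G (p + t *\<^sub>R d)
      = violations c G p + (\<Sum>i\<in>tight c G p. loss01 (G i \<bullet> (t *\<^sub>R d)))" .
  then show ?thesis
    using eventually_at_right_less[of "0::real"]
  proof eventually_elim
    case (elim t)
    then show ?case
      using assms by (auto simp: loss01_def zero_less_mult_iff not_less intro!: sum.neutral)
  qed
qed

section \<open>Subdifferentials\<close>

text \<open>
  A direction of the cone tests a regular subgradient against a function that is constant along it,
  which forces a nonpositive inner product.  Conversely, for a vector of the polar cone the difference
  quotient is eventually nonnegative: a displacement outside the cone gains at least one, more than
  the small inner product that is subtracted.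
\<close>

proposition regular_subdiff_violations:
  fixes G :: "'n::finite \<Rightarrow> 'a::euclidean_space"
  shows "regular_subdiff (violations c G) p =
    {v. \<forall>d. (\<forall>i\<in>tight c G p. G i \<bullet> d \<le> 0) \<longrightarrow> v \<bullet> d \<le> 0}"
proof (intro set_eqI iffI CollectI allI impI)
  fix v d
  assume v: "v \<in> regular_subdiff (violations c G) p"
    and d: "\<forall>i\<in>tight c G p. G i \<bullet> d \<le> 0"
  show "v \<bullet> d \<le> 0"
  proof (rule ccontr)
    assume "\<not> v \<bullet> d \<le> 0"
    then have pos: "v \<bullet> d > 0" and d0: "d \<noteq> 0" by auto
    define e where "e = (v \<bullet> d) / norm d"
    have e: "e > 0" using pos d0 by (simp add: e_def)
    have ev: "\<forall>\<^sub>F q in at p. ereal (- e) <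
        ereal ((violations c G q - violations c G p - v \<bullet> (q - p)) / norm (q - p))"
    proof -
      have "ereal (- e) < 0" using e by simp
      then show ?thesis
        using v unfolding regular_subdiff_def le_Liminf_iff by blast
    qed
    have "((\<lambda>t. p + t *\<^sub>R d) \<longlongrightarrow> p + 0 *\<^sub>R d) (at_right 0)"
      by (intro tendsto_intros)
    then have "filterlim (\<lambda>t. p + t *\<^sub>R d) (at p) (at_right 0)"
      using d0 by (auto simp: filterlim_at eventually_at_filter)
    from eventually_compose_filterlim[OF ev this]
    have "\<forall>\<^sub>F t in at_right 0. ereal (- e) < ereal ((violations c G (p + t *\<^sub>R d)
        - violations c G p - v \<bullet> (p + t *\<^sub>R d - p)) / norm (p + t *\<^sub>R d - p))" .
    then have "\<forall>\<^sub>F t::real in at_right 0. False"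
      using violations_along_cone[OF d] eventually_at_right_less[of "0::real"]
      by eventually_elim (simp add: e_def)
    then show False by simp
  qed
next
  fix v
  assume "v \<in> {v. \<forall>d. (\<forall>i\<in>tight c G p. G i \<bullet> d \<le> 0) \<longrightarrow> v \<bullet> d \<le> 0}"
  then have polar: "v \<bullet> d \<le> 0" if "\<forall>i\<in>tight c G p. G i \<bullet> d \<le> 0" for d
    using that by blast
  have lim: "((\<lambda>q. q - p) \<longlongrightarrow> p - p) (at p)"
    by (intro tendsto_intros)
  have "\<forall>\<^sub>F q in at p. violations c G (p + (q - p))
      = violations c G p + (\<Sum>i\<in>tight c G p. loss01 (G i \<bullet> (q - p)))"
    using lim by (intro eventually_compose_filterlim[OF violations_local]) simp
  moreover have "\<forall>\<^sub>F q in at p. v \<bullet> (q - p) < 1"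
    by (rule order_tendstoD(2)[OF tendsto_inner[OF tendsto_const lim]]) simp
  ultimately have "\<forall>\<^sub>F q in at p.
      0 \<le> ereal ((violations c G q - violations c G p - v \<bullet> (q - p)) / norm (q - p))"
  proof eventually_elim
    case (elim q)
    have "0 \<le> violations c G q - violations c G p - v \<bullet> (q - p)"
      using sum_loss01_cases[of "tight c G p" "\<lambda>i. G i \<bullet> (q - p)"] polar[of "q - p"] elim
      by auto
    then show ?case by simp
  qed
  then show "v \<in> regular_subdiff (violations c G) p"
    unfolding regular_subdiff_def by (simp add: Liminf_bounded)
qed

lemma regular_subdiff_violations_scale:
  assumes "v \<in> regular_subdiff (violations c G) p" "t > 0"
  shows "t *\<^sub>R v \<in> regular_subdiff (violations c G) p"
  using assms by (auto simp: regular_subdiff_violations mult_le_0_iff)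

lemma regular_subset_limiting: "regular_subdiff h p \<subseteq> limiting_subdiff h p"
proof
  fix v assume "v \<in> regular_subdiff h p"
  then show "v \<in> limiting_subdiff h p"
    unfolding limiting_subdiff_def
    by (intro CollectI exI[of _ "\<lambda>_. p"] exI[of _ "\<lambda>_. v"]) auto
qed

lemma limiting_subdiff_violations_scale:
  assumes "v \<in> limiting_subdiff (violations c G) p" "t > 0"
  shows "t *\<^sub>R v \<in> limiting_subdiff (violations c G) p"
proof -
  obtain X V where "X \<longlonglongrightarrow> p" "(\<lambda>k. violations c G (X k)) \<longlonglongrightarrow> violations c G p"
    "\<And>k. V k \<in> regular_subdiff (violations c G) (X k)" "V \<longlonglongrightarrow> v"
    using assms(1) unfolding limiting_subdiff_def by blast
  then show ?thesis
    unfolding limiting_subdiff_def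
    by (intro CollectI exI[of _ X] exI[of _ "\<lambda>k. t *\<^sub>R V k"])
      (auto intro!: tendsto_intros regular_subdiff_violations_scale[OF _ assms(2)])
qed

lemma scaled_limiting_subdiff_violations:
  assumes "t > 0"
  shows "(\<lambda>v. t *\<^sub>R v) ` limiting_subdiff (violations c G) p = limiting_subdiff (violations c G) p"
proof (intro equalityI subsetI)
  fix v assume v: "v \<in> limiting_subdiff (violations c G) p"
  show "v \<in> (\<lambda>v. t *\<^sub>R v) ` limiting_subdiff (violations c G) p"
    using limiting_subdiff_violations_scale[OF v, of "1 / t"] assms
    by (intro image_eqI[of _ _ "(1 / t) *\<^sub>R v"]) auto
qed (use assms limiting_subdiff_violations_scale in blast)

lemma g_fun_violations: "g_fun = violations (\<lambda>_. 0) (\<lambda>i. axis i 1)"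
  by (rule ext) (simp add: g_fun_eq_sum violations_def inner_axis')

lemma regular_subdiff_g_fun:
  fixes u :: "real^'n::finite"
  shows "regular_subdiff g_fun u = {z. \<forall>i. (u $ i = 0 \<longrightarrow> 0 \<le> z $ i) \<and> (u $ i \<noteq> 0 \<longrightarrow> z $ i = 0)}"
proof (intro set_eqI iffI CollectI allI conjI impI)
  fix z i
  assume "z \<in> regular_subdiff g_fun u"
  then have polar: "z \<bullet> d \<le> 0" if "\<And>i. u $ i = 0 \<Longrightarrow> d $ i \<le> 0" for d
    using that by (simp add: g_fun_violations regular_subdiff_violations tight_def inner_axis')
  have neg: "0 \<le> z $ i"
  proof -
    have "z \<bullet> axis i (-1) \<le> 0"
      by (intro polar) (auto simp: axis_def)
    then show ?thesis by (simp add: inner_axis)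
  qed
  then show "0 \<le> z $ i" .
  show "z $ i = 0" if "u $ i \<noteq> 0"
  proof -
    have "z \<bullet> axis i 1 \<le> 0"
      using that by (intro polar) (auto simp: axis_def)
    with neg show ?thesis by (simp add: inner_axis)
  qed
next
  fix z :: "real^'n"
  assume "z \<in> {z. \<forall>i. (u $ i = 0 \<longrightarrow> 0 \<le> z $ i) \<and> (u $ i \<noteq> 0 \<longrightarrow> z $ i = 0)}"
  then have z: "u $ i = 0 \<Longrightarrow> 0 \<le> z $ i" "u $ i \<noteq> 0 \<Longrightarrow> z $ i = 0" for i
    by auto
  have "z \<bullet> d \<le> 0" if "\<forall>i. u $ i = 0 \<longrightarrow> d $ i \<le> 0" for d
    unfolding inner_vec_def
  proof (rule sum_nonpos)
    fix i
    show "z $ i \<bullet> d $ i \<le> 0"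
      using that z[of i] by (cases "u $ i = 0") (auto simp: mult_nonneg_nonpos)
  qed
  then show "z \<in> regular_subdiff g_fun u"
    by (simp add: g_fun_violations regular_subdiff_violations tight_def inner_axis')
qed

text \<open>
  Passing to limits adds nothing here: nonzero coordinates stay nonzero along the approximating points,
  so the regular subgradients there satisfy the constraints of the limit point.
\<close>

lemma limiting_subdiff_g_fun:
  fixes u :: "real^'n::finite"
  shows "limiting_subdiff g_fun u = {z. \<forall>i. (u $ i = 0 \<longrightarrow> 0 \<le> z $ i) \<and> (u $ i \<noteq> 0 \<longrightarrow> z $ i = 0)}"
proof (intro equalityI subsetI CollectI allI conjI impI)
  fix z i
  assume "z \<in> limiting_subdiff g_fun u"
  then obtain X V where X: "X \<longlonglongrightarrow> u" and VX: "\<forall>k. V k \<in> regular_subdiff g_fun (X k)"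
    and V: "V \<longlonglongrightarrow> z"
    unfolding limiting_subdiff_def by blast
  have mem: "(X k $ i = 0 \<longrightarrow> 0 \<le> V k $ i) \<and> (X k $ i \<noteq> 0 \<longrightarrow> V k $ i = 0)" for k
    using VX by (simp add: regular_subdiff_g_fun)
  have reg: "0 \<le> V k $ i" for k
    using mem[of k] by (cases "X k $ i = 0") simp_all
  have reg0: "X k $ i \<noteq> 0 \<Longrightarrow> V k $ i = 0" for k
    using mem[of k] by simp
  have Vi: "(\<lambda>k. V k $ i) \<longlonglongrightarrow> z $ i" and Xi: "(\<lambda>k. X k $ i) \<longlonglongrightarrow> u $ i"
    using V X by (auto intro: tendsto_vec_nth)
  show "0 \<le> z $ i"
    using reg by (intro LIMSEQ_le_const[OF Vi]) auto
  show "z $ i = 0" if "u $ i \<noteq> 0"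
  proof -
    have "\<forall>\<^sub>F k in sequentially. X k $ i \<noteq> 0"
      using tendsto_imp_eventually_ne[OF Xi that] .
    then have "\<forall>\<^sub>F k in sequentially. V k $ i = 0"
      by (rule eventually_mono) (rule reg0)
    then show ?thesis
      by (intro LIMSEQ_unique[OF Vi] tendsto_eventually)
  qed
next
  fix z :: "real^'n"
  assume "z \<in> {z. \<forall>i. (u $ i = 0 \<longrightarrow> 0 \<le> z $ i) \<and> (u $ i \<noteq> 0 \<longrightarrow> z $ i = 0)}"
  then show "z \<in> limiting_subdiff g_fun u"
    unfolding regular_subdiff_g_fun[symmetric] by (rule subsetD[OF regular_subset_limiting])
qed

section \<open>Farkas' lemma\<close>

text \<open>
  The finitely generated cone is closed, so a vector outside it could be strictly separated from it,
  and the negated normal would contradict the polarity hypothesis.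
\<close>

lemma farkas:
  fixes G :: "'i \<Rightarrow> 'a::euclidean_space"
  assumes "finite I"
    and polar: "\<And>d. (\<And>i. i \<in> I \<Longrightarrow> G i \<bullet> d \<le> 0) \<Longrightarrow> v \<bullet> d \<le> 0"
  shows "\<exists>z. (\<forall>i\<in>I. 0 \<le> z i) \<and> v = (\<Sum>i\<in>I. z i *\<^sub>R G i)"
proof -
  let ?H = "convex_cone hull (G ` I)"
  let ?C = "{w. \<exists>z. (\<forall>i\<in>I. 0 \<le> z i) \<and> w = (\<Sum>i\<in>I. z i *\<^sub>R G i)}"
  have "v \<in> ?H"
  proof (rule ccontr)
    assume notin: "v \<notin> ?H"
    have "closed ?H"
      using assms(1) by (simp add: closed_convex_cone_hull)
    from separating_hyperplane_closed_point[OF convex_convex_cone_hull this notin]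
    obtain a b where av: "a \<bullet> v < b" and ab: "\<forall>w\<in>?H. a \<bullet> w > b"
      by blast
    have b: "b < 0"
      using bspec[OF ab convex_cone_hull_contains_0] by simp
    have "0 \<le> a \<bullet> G i" if i: "i \<in> I" for i
    proof (rule ccontr)
      assume neg: "\<not> 0 \<le> a \<bullet> G i"
      \<comment> \<open>scaled so that the generator lands on the separating hyperplane\<close>
      have "(b / (a \<bullet> G i)) *\<^sub>R G i \<in> ?H"
      proof (rule convex_cone_hull_mul[OF hull_inc])
        show "G i \<in> G ` I" using i by simp
        show "0 \<le> b / (a \<bullet> G i)" using b neg by (intro divide_nonpos_neg) simp_all
      qed
      from bspec[OF ab this] neg show False by simp
    qed
    then have "v \<bullet> (- a) \<le> 0"
      by (intro polar) (simp add: inner_commute)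
    with av b show False by (simp add: inner_commute)
  qed
  also have "?H \<subseteq> ?C"
  proof (rule hull_minimal)
    show "G ` I \<subseteq> ?C"
    proof (rule image_subsetI)
      fix i assume i: "i \<in> I"
      let ?z = "\<lambda>j. if j = i then 1 else 0 :: real"
      have "(\<Sum>j\<in>I - {i}. ?z j *\<^sub>R G j) = 0"
        by (rule sum.neutral) simp
      then have "G i = (\<Sum>j\<in>I. ?z j *\<^sub>R G j)"
        by (simp add: sum.remove[OF assms(1) i, of "\<lambda>j. ?z j *\<^sub>R G j"])
      then show "G i \<in> ?C"
        by (intro CollectI exI[of _ ?z] conjI) simp_all
    qed
    have zero: "0 \<in> ?C"
      by (intro CollectI exI[of _ "\<lambda>_. 0"]) simp
    have add: "u + w \<in> ?C" if "u \<in> ?C" "w \<in> ?C" for u w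
    proof -
      from that obtain z z' where "\<forall>i\<in>I. 0 \<le> z i" "u = (\<Sum>i\<in>I. z i *\<^sub>R G i)"
        "\<forall>i\<in>I. 0 \<le> z' i" "w = (\<Sum>i\<in>I. z' i *\<^sub>R G i)" by blast
      then show ?thesis
        by (intro CollectI exI[of _ "\<lambda>i. z i + z' i"]) (simp add: sum.distrib scaleR_add_left)
    qed
    have scale: "t *\<^sub>R w \<in> ?C" if "w \<in> ?C" "0 \<le> t" for w t
    proof -
      from that(1) obtain z where "\<forall>i\<in>I. 0 \<le> z i" "w = (\<Sum>i\<in>I. z i *\<^sub>R G i)" by blast
      with that(2) show ?thesis
        by (intro CollectI exI[of _ "\<lambda>i. t * z i"]) (simp add: scaleR_sum_right)
    qed
    show "convex_cone ?C"
      unfolding convex_cone_iff by (intro conjI ballI allI impI zero add scale)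
  qed
  finally show ?thesis
    by (rule CollectD)
qed

section \<open>Second-order growth\<close>

text \<open>
  The function \<open>q\<close> is the quadratic part of \<open>f\<close>, and the stationarity condition with multiplier
  \<open>z\<close> is built into the expansion.  The last hypothesis is the second-order condition: \<open>q\<close> is
  positive in the directions that are complementary to \<open>z\<close>.
\<close>

proposition violations_second_order_growth:
  fixes G :: "'n::finite \<Rightarrow> 'a::euclidean_space"
  assumes lam: "lam > 0"
    and expansion: "\<And>d. f (p + d) = f p - (\<Sum>i\<in>UNIV. z i *\<^sub>R G i) \<bullet> d + q d"
    and z_nonneg: "\<And>i. 0 \<le> z i" and z_zero: "\<And>i. i \<notin> tight c G p \<Longrightarrow> z i = 0"
    and q_cont: "continuous_on UNIV q" and q_nonneg: "\<And>d. 0 \<le> q d"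
    and q_scale: "\<And>t d. q (t *\<^sub>R d) = t\<^sup>2 * q d"
    and q_pos: "\<And>d. d \<noteq> 0 \<Longrightarrow> (\<And>i. i \<in> tight c G p \<Longrightarrow> G i \<bullet> d = 0 \<or> z i = 0) \<Longrightarrow> 0 < q d"
  shows "\<exists>\<kappa>>0. \<exists>\<delta>>0. \<forall>d. norm d < \<delta> \<longrightarrow>
    f (p + d) + lam * violations c G (p + d) \<ge> f p + lam * violations c G p + \<kappa> * (norm d)\<^sup>2"
proof -
  let ?T = "tight c G p"
  define v where "v = (\<Sum>i\<in>UNIV. z i *\<^sub>R G i)"
  have v_inner: "v \<bullet> d = (\<Sum>i\<in>UNIV. z i * (G i \<bullet> d))" for d
    by (simp add: v_def inner_sum_left)
  have v_terms: "z i * (G i \<bullet> d) \<le> 0" if "\<forall>i\<in>?T. G i \<bullet> d \<le> 0" for i d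
    using that z_nonneg[of i] z_zero[of i] by (cases "i \<in> ?T") (auto simp: mult_nonneg_nonpos)
  have v_polar: "v \<bullet> d \<le> 0" if "\<forall>i\<in>?T. G i \<bullet> d \<le> 0" for d
    unfolding v_inner using v_terms[OF that] by (intro sum_nonpos)
  \<comment> \<open>Directions outside the cone are left to the jump, so only this compact set matters for curvature.\<close>
  define K where "K = sphere 0 1 \<inter> {d. \<forall>i\<in>?T. G i \<bullet> d \<le> 0}"
  have "closed (\<Inter>i\<in>?T. {d. G i \<bullet> d \<le> 0})"
    by (intro closed_INT ballI closed_Collect_le continuous_intros)
  also have "(\<Inter>i\<in>?T. {d. G i \<bullet> d \<le> 0}) = {d. \<forall>i\<in>?T. G i \<bullet> d \<le> 0}"
    by auto
  finally have "closed {d. \<forall>i\<in>?T. G i \<bullet> d \<le> 0}" .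
  then have "compact K"
    unfolding K_def by (intro compact_Int_closed) auto
  have pos: "0 < q d - v \<bullet> d" if "d \<in> K" for d
  proof (cases "v \<bullet> d = 0")
    case True
    have cone: "\<forall>i\<in>?T. G i \<bullet> d \<le> 0" using that by (simp add: K_def)
    have "(\<Sum>i\<in>UNIV. - (z i * (G i \<bullet> d))) = 0"
      using True by (simp add: v_inner sum_negf)
    then have "\<forall>i. z i * (G i \<bullet> d) = 0"
      using v_terms[OF cone] by (subst (asm) sum_nonneg_eq_0_iff) auto
    then have "0 < q d"
      using that by (intro q_pos) (auto simp: K_def)
    with True show ?thesis by simp
  next
    case False
    with v_polar[of d] q_nonneg[of d] that show ?thesis by (simp add: K_def)
  qed
  obtain \<kappa> where \<kappa>: "\<kappa> > 0" "\<And>d. d \<in> K \<Longrightarrow> \<kappa> \<le> q d - v \<bullet> d"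
  proof (cases "K = {}")
    case True
    then show ?thesis using that[of 1] by simp
  next
    case False
    have "continuous_on K (\<lambda>d. q d - v \<bullet> d)"
      by (intro continuous_intros continuous_on_subset[OF q_cont]) auto
    then obtain d0 where "d0 \<in> K" "\<And>d. d \<in> K \<Longrightarrow> q d0 - v \<bullet> d0 \<le> q d - v \<bullet> d"
      using continuous_attains_inf[OF \<open>compact K\<close> False] by blast
    then show ?thesis using that pos by blast
  qed
  obtain \<delta>0 where \<delta>0: "\<delta>0 > 0" and loc: "\<And>d. norm d < \<delta>0 \<Longrightarrow>
      violations c G (p + d) = violations c G p + (\<Sum>i\<in>?T. loss01 (G i \<bullet> d))"
    using violations_local[of c G p] unfolding eventually_nhds_metric by (auto simp: dist_norm)
  \<comment> \<open>The third bound makes \<open>lam\<close> exceed both the linear term and the growth term when a jump occurs.\<close>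
  define \<delta> where "\<delta> = min 1 (min \<delta>0 (lam / (norm v + \<kappa>)))"
  have den: "norm v + \<kappa> > 0" using \<kappa>(1) by (simp add: add_nonneg_pos)
  have "\<delta> > 0" using \<delta>0 lam den by (simp add: \<delta>_def)
  moreover have "f (p + d) + lam * violations c G (p + d) \<ge> f p + lam * violations c G p + \<kappa> * (norm d)\<^sup>2"
    if "norm d < \<delta>" for d
  proof -
    let ?N = "\<Sum>i\<in>?T. loss01 (G i \<bullet> d)"
    have d1: "norm d < 1" and d2: "norm d < \<delta>0" and d3: "norm d * (norm v + \<kappa>) < lam"
      using that den by (auto simp: \<delta>_def field_simps)
    have sq: "(norm d)\<^sup>2 \<le> norm d"
      using d1 by (simp add: power2_eq_square mult_left_le)
    have "\<kappa> * (norm d)\<^sup>2 \<le> q d - v \<bullet> d + lam * ?N"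
    proof (cases "(\<forall>i\<in>?T. G i \<bullet> d \<le> 0) \<and> ?N = 0")
      case True
      show ?thesis
      proof (cases "d = 0")
        case True
        then show ?thesis using q_scale[of 0 d] by (simp add: loss01_def)
      next
        case False
        define e where "e = (1 / norm d) *\<^sub>R d"
        have d_e: "d = norm d *\<^sub>R e" using False by (simp add: e_def)
        have "e \<in> K"
          using False True by (auto simp: K_def e_def divide_nonpos_nonneg)
        then have "\<kappa> * (norm d)\<^sup>2 \<le> (norm d)\<^sup>2 * (q e - v \<bullet> e)"
          using mult_right_mono[OF \<kappa>(2)[of e], of "(norm d)\<^sup>2"] by (simp add: mult.commute)
        also have "\<dots> = q d - (norm d)\<^sup>2 * (v \<bullet> e)"
          using q_scale[of "norm d" e] d_e by (simp add: right_diff_distrib)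
        \<comment> \<open>The linear term is nonpositive and dominates its square-scaled version for short steps.\<close>
        also have "\<dots> \<le> q d - norm d * (v \<bullet> e)"
          using mult_right_mono_neg[OF sq, of "v \<bullet> e"] v_polar[of e] \<open>e \<in> K\<close> by (simp add: K_def)
        also have "\<dots> = q d - v \<bullet> d"
          using arg_cong[OF d_e, of "\<lambda>w. v \<bullet> w"] by simp
        finally show ?thesis using True by simp
      qed
    next
      case False
      then have "?N \<ge> 1"
        using sum_loss01_cases[of ?T "\<lambda>i. G i \<bullet> d"] by auto
      then have "lam * ?N \<ge> lam" using lam by simp
      moreover have "v \<bullet> d \<le> norm v * norm d" by (rule norm_cauchy_schwarz)
      moreover have "\<kappa> * (norm d)\<^sup>2 \<le> \<kappa> * norm d" using sq \<kappa>(1) by simp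
      ultimately show ?thesis
        using d3 q_nonneg[of d] by (simp add: algebra_simps)
    qed
    then show ?thesis
      using loc[OF d2] expansion[of d] by (simp add: v_def algebra_simps)
  qed
  ultimately show ?thesis using \<kappa>(1) by blast
qed

section \<open>The training problem\<close>

definition residual :: "real^'m \<Rightarrow> 'm::finite qparam \<Rightarrow> real^'m" where
  "residual u = (\<lambda>(W, b, c). W *v u + b)"

lemma linear_residual: "linear (residual u)"
  by (rule linearI)
    (auto simp: residual_def matrix_vector_mult_add_rdistrib scaleR_matrix_vector_assoc scaleR_add_right)

lemma f_obj_residual: "f_obj x p = (\<Sum>i\<in>UNIV. residual (x i) p \<bullet> residual (x i) p) / 2"
  by (cases p) (simp add: f_obj_def residual_def power2_norm_eq_inner sum_divide_distrib)

lemma grad_f_obj: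
  fixes x :: "'n::finite \<Rightarrow> real^'m::finite"
  shows "grad (f_obj x) p = (\<Sum>i\<in>UNIV. adjoint (residual (x i)) (residual (x i) p))"
proof (rule grad_eqI)
  have der: "(residual u has_derivative residual u) (at p)" for u :: "real^'m"
    by (intro bounded_linear_imp_has_derivative linear_conv_bounded_linear[THEN iffD1] linear_residual)
  have "((\<lambda>p. (\<Sum>i\<in>UNIV. residual (x i) p \<bullet> residual (x i) p) / 2) has_derivative
      (\<lambda>d. (\<Sum>i\<in>UNIV. residual (x i) p \<bullet> residual (x i) d + residual (x i) d \<bullet> residual (x i) p) / 2)) (at p)"
    by (intro bounded_linear.has_derivative[OF bounded_linear_divide] has_derivative_sum
        has_derivative_inner der)
  moreover have "residual (x i) p \<bullet> residual (x i) d + residual (x i) d \<bullet> residual (x i) p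
      = 2 * (d \<bullet> adjoint (residual (x i)) (residual (x i) p))" for i d
    by (simp add: adjoint_works[OF linear_residual] inner_commute)
  ultimately show "GDERIV (f_obj x) p :> (\<Sum>i\<in>UNIV. adjoint (residual (x i)) (residual (x i) p))"
    by (simp add: gderiv_def f_obj_residual[abs_def] inner_sum_right flip: sum_distrib_left)
qed

text \<open>
  The expansion is exact because the objective is a homogeneous quadratic form; its second-order term
  is the objective itself, evaluated at the displacement.
\<close>

lemma f_obj_expansion:
  fixes x :: "'n::finite \<Rightarrow> real^'m::finite"
  shows "f_obj x (p + d) = f_obj x p + grad (f_obj x) p \<bullet> d + f_obj x d"
proof -
  have "residual u (p + d) \<bullet> residual u (p + d) = residual u p \<bullet> residual u p
      + 2 * (adjoint (residual u) (residual u p) \<bullet> d) + residual u d \<bullet> residual u d" for u :: "real^'m"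
    using adjoint_works[OF linear_residual, of d u "residual u p"]
    by (simp add: linear_add[OF linear_residual] inner_add_left inner_add_right inner_commute)
  then show ?thesis
    by (simp add: f_obj_residual grad_f_obj sum.distrib inner_sum_left add_divide_distrib
        flip: sum_distrib_left)
qed

lemma f_obj_nonneg: "0 \<le> f_obj x d"
  by (simp add: f_obj_residual sum_nonneg)

lemma f_obj_scale: "f_obj x (t *\<^sub>R d) = t\<^sup>2 * f_obj x d"
  by (simp add: f_obj_residual linear_scale[OF linear_residual] sum_distrib_left power2_eq_square
      mult.assoc)

lemma continuous_f_obj: "continuous_on UNIV (f_obj x)"
  unfolding f_obj_residual[abs_def]
  by (intro continuous_on_divide continuous_on_sum continuous_on_inner continuous_on_const
      linear_continuous_on linear_conv_bounded_linear[THEN iffD1] linear_residual) simp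

lemma quad_inner: "quad q u = q \<bullet> ((1/2) *\<^sub>R (\<chi> k l. u $ k * u $ l), u, 1)"
  by (cases q) (simp add: quad_def inner_outer)

lemma grad_F_comp_inner: "grad (F_comp x y i) p \<bullet> d = - y i * quad d (x i)"
  by (simp only: grad_F_comp quad_inner inner_scaleR_left inner_commute[of d])

lemma F_comp_affine: "F_comp x y i q = 1 + grad (F_comp x y i) p \<bullet> q"
  by (simp add: F_comp_def grad_F_comp_inner)

text \<open>
  The constraint functions are affine, so their gradients may be taken at any base point \<open>p\<close>; fixing
  one makes the gradients agree literally with those in the multiplier equation at \<open>p\<close>.
\<close>

lemma phi_violations: "phi x y = violations (\<lambda>_. 1) (\<lambda>i. grad (F_comp x y i) p)"
  by (rule ext) (simp add: phi_def violations_def flip: F_comp_affine)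

lemma tight_eq_active: "tight (\<lambda>_. 1) (\<lambda>i. grad (F_comp x y i) p) q = active x y q"
  by (auto simp: tight_def active_def grad_F_comp_inner)

lemma F_map_eq_0_iff: "F_map x y p $ i = 0 \<longleftrightarrow> i \<in> active x y p"
  by (auto simp: F_map_def F_comp_def active_def)

lemma multipliers_iff:
  "z \<in> multipliers x y p V \<longleftrightarrow> (\<forall>i. 0 \<le> z $ i) \<and> (\<forall>i. i \<notin> active x y p \<longrightarrow> z $ i = 0) \<and>
    (\<Sum>i\<in>UNIV. z $ i *\<^sub>R grad (F_comp x y i) p) = V"
  unfolding multipliers_def limiting_subdiff_g_fun by (auto simp: F_map_eq_0_iff) (metis order_refl)

lemma local_minimizer_imp_regular_subdiff:
  assumes "local_minimizer h p"
  shows "0 \<in> regular_subdiff h p"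
proof -
  obtain \<delta> where "\<delta> > 0" "\<And>q. q \<in> ball p \<delta> \<Longrightarrow> h p \<le> h q"
    using assms unfolding local_minimizer_def by blast
  then have "\<forall>\<^sub>F q in at p. 0 \<le> ereal ((h q - h p - 0 \<bullet> (q - p)) / norm (q - p))"
    unfolding eventually_at by (auto simp: dist_commute intro!: exI[of _ \<delta>])
  then show ?thesis
    unfolding regular_subdiff_def by (simp add: Liminf_bounded)
qed

text \<open>
  Along a direction of the cone the penalty is constant for short steps, so minimality concerns the
  quadratic objective alone; dividing its increment by the step length and letting it tend to zero
  gives the sign of the directional derivative.
\<close>

lemma local_minimizer_imp_stationary:
  fixes p :: "'m::finite qparam"
  assumes min: "local_minimizer (Q_obj x y lam) p"
  shows "- grad (f_obj x) p \<in> regular_subdiff (phi x y) p"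
proof -
  let ?G = "\<lambda>i. grad (F_comp x y i) p"
  have "- grad (f_obj x) p \<bullet> d \<le> 0" if cone: "\<forall>i\<in>active x y p. ?G i \<bullet> d \<le> 0" for d
  proof -
    let ?s = "grad (f_obj x) p \<bullet> d"
    obtain \<delta> where "\<delta> > 0" and \<delta>: "\<And>q. q \<in> ball p \<delta> \<Longrightarrow> Q_obj x y lam p \<le> Q_obj x y lam q"
      using min unfolding local_minimizer_def by blast
    have lim: "((\<lambda>t. p + t *\<^sub>R d) \<longlongrightarrow> p + 0 *\<^sub>R d) (at_right 0)"
      by (intro tendsto_intros)
    have "\<forall>\<^sub>F t in at_right 0. p + t *\<^sub>R d \<in> ball p \<delta>"
      using \<open>\<delta> > 0\<close> by (intro topological_tendstoD[OF lim]) auto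
    moreover have "\<forall>\<^sub>F t in at_right 0. phi x y (p + t *\<^sub>R d) = phi x y p"
      unfolding phi_violations[of x y p]
      by (rule violations_along_cone) (use cone in \<open>simp add: tight_eq_active\<close>)
    ultimately have "\<forall>\<^sub>F t in at_right 0. 0 \<le> ?s + t * f_obj x d"
      using eventually_at_right_less[of "0::real"]
    proof eventually_elim
      case (elim t)
      have "0 \<le> t * (?s + t * f_obj x d)"
        using \<delta>[OF elim(1)] elim(2)
        by (simp add: Q_obj_def f_obj_expansion f_obj_scale algebra_simps power2_eq_square)
      with elim(3) show ?case by (simp add: zero_le_mult_iff)
    qed
    moreover have "((\<lambda>t. ?s + t * f_obj x d) \<longlongrightarrow> ?s + 0 * f_obj x d) (at_right 0)"
      by (intro tendsto_intros)
    ultimately have "0 \<le> ?s + 0 * f_obj x d"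
      by (intro tendsto_lowerbound) auto
    then show ?thesis by simp
  qed
  then show ?thesis
    by (simp add: phi_violations[of x y p] regular_subdiff_violations tight_eq_active)
qed

text \<open>
  Farkas' lemma provides coefficients on the active indices only.  Extended by zero, they satisfy
  the sign pattern that characterises the limiting subdifferential of \<open>g\<close>.
\<close>

lemma regular_subgradient_imp_multiplier:
  fixes p :: "'m::finite qparam"
  assumes "v \<in> regular_subdiff (phi x y) p"
  shows "\<exists>z. z \<in> multipliers x y p v"
proof -
  let ?G = "\<lambda>i. grad (F_comp x y i) p"
  have polar: "v \<bullet> d \<le> 0" if "\<And>i. i \<in> active x y p \<Longrightarrow> ?G i \<bullet> d \<le> 0" for d
    using assms that
    unfolding phi_violations[of x y p] regular_subdiff_violations tight_eq_active by blast
  obtain z where z: "\<forall>i\<in>active x y p. 0 \<le> z i" "v = (\<Sum>i\<in>active x y p. z i *\<^sub>R ?G i)"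
    using farkas[of "active x y p" ?G v, OF finite polar] by blast
  let ?z = "\<chi> i. if i \<in> active x y p then z i else 0"
  have "(\<Sum>i\<in>UNIV. ?z $ i *\<^sub>R ?G i) = v"
    unfolding z(2) by (rule sum.mono_neutral_cong_right) auto
  with z(1) have "?z \<in> multipliers x y p v"
    by (simp add: multipliers_iff)
  then show ?thesis ..
qed

lemma second_order_sufficient:
  fixes p :: "'m::finite qparam"
  assumes labels: "\<forall>i. y i \<in> {-1, 1}" and lam: "lam > 0"
    and z: "z \<in> multipliers x y p (- grad (f_obj x) p)"
    and pos: "\<And>d. d \<in> critical_set x y p z \<Longrightarrow> d \<noteq> 0 \<Longrightarrow> 0 < f_obj x d"
  shows "\<exists>\<kappa>>0. \<exists>\<delta>>0. \<forall>d. norm d < \<delta> \<longrightarrow>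
    Q_obj x y lam (p + d) \<ge> Q_obj x y lam p + \<kappa> * (norm d)\<^sup>2"
  unfolding Q_obj_def phi_violations[of x y p]
proof (rule violations_second_order_growth[where z = "\<lambda>i. z $ i" and q = "f_obj x"])
  have z': "\<forall>i. 0 \<le> z $ i" "\<forall>i. i \<notin> active x y p \<longrightarrow> z $ i = 0"
    "(\<Sum>i\<in>UNIV. z $ i *\<^sub>R grad (F_comp x y i) p) = - grad (f_obj x) p"
    using z by (auto simp: multipliers_iff)
  show "f_obj x (p + d) = f_obj x p - (\<Sum>i\<in>UNIV. z $ i *\<^sub>R grad (F_comp x y i) p) \<bullet> d + f_obj x d" for d
    by (simp add: f_obj_expansion z'(3))
  show "0 \<le> z $ i" for i using z'(1) by blast
  show "z $ i = 0" if "i \<notin> tight (\<lambda>_. 1) (\<lambda>i. grad (F_comp x y i) p) p" for i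
    using that z'(2) by (simp add: tight_eq_active)
  \<comment> \<open>Nonzero labels let vanishing of a gradient term be read as vanishing of the quadratic function.\<close>
  show "0 < f_obj x d" if d: "d \<noteq> 0" and flat: "\<And>i. i \<in> tight (\<lambda>_. 1) (\<lambda>i. grad (F_comp x y i) p) p \<Longrightarrow>
      grad (F_comp x y i) p \<bullet> d = 0 \<or> z $ i = 0" for d
  proof (rule pos[OF _ d])
    have "y i \<noteq> 0" for i using labels[rule_format, of i] by auto
    then show "d \<in> critical_set x y p z"
      using flat z'(1) by (auto simp: critical_set_def tight_eq_active grad_F_comp_inner)
  qed
qed (use lam in \<open>auto simp: continuous_f_obj f_obj_nonneg f_obj_scale\<close>)

theorem mainTheorem4:
  fixes x :: "'n::finite \<Rightarrow> real^'m::finite"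
    and y :: "'n \<Rightarrow> real"
    and lam :: real
    and Wst :: "real^'m^'m" and bst :: "real^'m" and cst :: real
  assumes labels: "\<forall>i. y i \<in> {-1, 1}"
    and lam_pos: "lam > 0"
    and qualification:
      "\<forall>z :: 'n \<Rightarrow> real.
         (\<forall>i\<in>active x y (Wst, bst, cst). z i \<ge> 0) \<and>
         (\<Sum>i\<in>active x y (Wst, bst, cst). z i *\<^sub>R grad (F_comp x y i) (Wst, bst, cst)) = (0, 0, 0)
         \<longrightarrow> (\<forall>i\<in>active x y (Wst, bst, cst). z i = 0)"
  shows
    "(local_minimizer (Q_obj x y lam) (Wst, bst, cst) \<longrightarrow>
        0 \<in> limiting_subdiff (Q_obj x y lam) (Wst, bst, cst) \<and>
        - grad (f_obj x) (Wst, bst, cst)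
          \<in> (\<lambda>v. lam *\<^sub>R v) ` limiting_subdiff (phi x y) (Wst, bst, cst) \<and>
        (\<lambda>v. lam *\<^sub>R v) ` limiting_subdiff (phi x y) (Wst, bst, cst)
          = limiting_subdiff (phi x y) (Wst, bst, cst) \<and>
        (\<exists>z \<in> multipliers x y (Wst, bst, cst) (- grad (f_obj x) (Wst, bst, cst)).
           \<forall>(D1, d2, d3) \<in> critical_set x y (Wst, bst, cst) z.
             (\<Sum>i\<in>UNIV. (norm (D1 *v x i + d2))\<^sup>2) \<ge> 0))
     \<and>
     (0 \<in> limiting_subdiff (Q_obj x y lam) (Wst, bst, cst) \<and>
      (\<exists>z \<in> multipliers x y (Wst, bst, cst) (- grad (f_obj x) (Wst, bst, cst)).
         \<forall>(D1, d2, d3) \<in> critical_set x y (Wst, bst, cst) z - {0}.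
           (\<Sum>i\<in>UNIV. (norm (D1 *v x i + d2))\<^sup>2) > 0)
      \<longrightarrow>
        local_minimizer (Q_obj x y lam) (Wst, bst, cst) \<and>
        (\<exists>\<kappa>>0. \<exists>\<delta>>0. \<forall>(W, b, c) \<in> ball (Wst, bst, cst) \<delta>.
           f_obj x (W, b, c) + lam * norm0 (pos_part (F_map x y (W, b, c)))
           \<ge> f_obj x (Wst, bst, cst) + lam * norm0 (pos_part (F_map x y (Wst, bst, cst)))
             + \<kappa> * ((norm (W - Wst))\<^sup>2 + (norm ((b, c) - (bst, cst)))\<^sup>2)))"
proof (intro conjI impI)
  let ?p = "(Wst, bst, cst)"
  have phi: "phi x y = violations (\<lambda>_. 1) (\<lambda>i. grad (F_comp x y i) ?p)"
    by (rule phi_violations)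
  show scale: "(\<lambda>v. lam *\<^sub>R v) ` limiting_subdiff (phi x y) ?p = limiting_subdiff (phi x y) ?p"
    unfolding phi by (rule scaled_limiting_subdiff_violations[OF lam_pos])
  {
    assume min: "local_minimizer (Q_obj x y lam) ?p"
    show "0 \<in> limiting_subdiff (Q_obj x y lam) ?p"
      using local_minimizer_imp_regular_subdiff[OF min] regular_subset_limiting by blast
    show "- grad (f_obj x) ?p \<in> (\<lambda>v. lam *\<^sub>R v) ` limiting_subdiff (phi x y) ?p"
      unfolding scale using local_minimizer_imp_stationary[OF min] regular_subset_limiting by blast
    show "\<exists>z \<in> multipliers x y ?p (- grad (f_obj x) ?p).
        \<forall>(D1, d2, d3) \<in> critical_set x y ?p z. (\<Sum>i\<in>UNIV. (norm (D1 *v x i + d2))\<^sup>2) \<ge> 0"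
    proof -
      obtain z where z: "z \<in> multipliers x y ?p (- grad (f_obj x) ?p)"
        using regular_subgradient_imp_multiplier[OF local_minimizer_imp_stationary[OF min]] ..
      show ?thesis
        by (intro bexI[OF _ z]) (simp add: sum_nonneg split: prod.split)
    qed
  }
  assume "0 \<in> limiting_subdiff (Q_obj x y lam) ?p \<and>
      (\<exists>z \<in> multipliers x y ?p (- grad (f_obj x) ?p).
         \<forall>(D1, d2, d3) \<in> critical_set x y ?p z - {0}.
           (\<Sum>i\<in>UNIV. (norm (D1 *v x i + d2))\<^sup>2) > 0)"
  then obtain z where z: "z \<in> multipliers x y ?p (- grad (f_obj x) ?p)"
    and pos: "\<And>D1 d2 d3. (D1, d2, d3) \<in> critical_set x y ?p z \<Longrightarrow> (D1, d2, d3) \<noteq> 0 \<Longrightarrow>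
      0 < (\<Sum>i\<in>UNIV. (norm (D1 *v x i + d2))\<^sup>2)"
    by blast
  have "0 < f_obj x d" if "d \<in> critical_set x y ?p z" "d \<noteq> 0" for d
  proof (cases d)
    case (fields D1 d2 d3)
    then show ?thesis
      using pos[of D1 d2 d3] that by (simp add: f_obj_def flip: sum_divide_distrib)
  qed
  from second_order_sufficient[OF labels lam_pos z this]
  obtain \<kappa> \<delta> where "\<kappa> > 0" "\<delta> > 0" and growth: "\<And>d. norm d < \<delta> \<Longrightarrow>
      Q_obj x y lam (?p + d) \<ge> Q_obj x y lam ?p + \<kappa> * (norm d)\<^sup>2"
    by blast
  have growth': "Q_obj x y lam q \<ge> Q_obj x y lam ?p + \<kappa> * (norm (q - ?p))\<^sup>2"
    if "q \<in> ball ?p \<delta>" for q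
    using growth[of "q - ?p"] that by (simp add: dist_norm norm_minus_commute)
  show "local_minimizer (Q_obj x y lam) ?p"
    unfolding local_minimizer_def
  proof (intro exI conjI ballI)
    fix q assume "q \<in> ball ?p \<delta>"
    moreover have "0 \<le> \<kappa> * (norm (q - ?p))\<^sup>2" using \<open>\<kappa> > 0\<close> by simp
    ultimately show "Q_obj x y lam ?p \<le> Q_obj x y lam q" using growth'[of q] by linarith
  qed (rule \<open>\<delta> > 0\<close>)
  have norm_sq: "(norm ((W, b, c) - ?p))\<^sup>2 = (norm (W - Wst))\<^sup>2 + (norm ((b, c) - (bst, cst)))\<^sup>2"
    for W b c
    by (simp add: norm_Pair)
  show "\<exists>\<kappa>>0. \<exists>\<delta>>0. \<forall>(W, b, c) \<in> ball ?p \<delta>.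
      f_obj x (W, b, c) + lam * norm0 (pos_part (F_map x y (W, b, c)))
      \<ge> f_obj x ?p + lam * norm0 (pos_part (F_map x y ?p))
        + \<kappa> * ((norm (W - Wst))\<^sup>2 + (norm ((b, c) - (bst, cst)))\<^sup>2)"
  proof (intro exI conjI ballI)
    fix q :: "'m qparam" assume q: "q \<in> ball ?p \<delta>"
    obtain W b c where q_eq: "q = (W, b, c)" by (cases q)
    have "Q_obj x y lam r = f_obj x r + lam * norm0 (pos_part (F_map x y r))" for r
      by (simp add: Q_obj_def phi_eq g_fun_def)
    with growth'[OF q] show "case q of (W, b, c) \<Rightarrow>
      f_obj x (W, b, c) + lam * norm0 (pos_part (F_map x y (W, b, c)))
      \<ge> f_obj x ?p + lam * norm0 (pos_part (F_map x y ?p))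
        + \<kappa> * ((norm (W - Wst))\<^sup>2 + (norm ((b, c) - (bst, cst)))\<^sup>2)"
      unfolding q_eq norm_sq by simp
  qed (rule \<open>\<kappa> > 0\<close> \<open>\<delta> > 0\<close>)+
qed

end
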